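(* Let $G$ be a finite graph cellularly embedded in a compact, connected, orientable, boundaryless surface $\Sigma$ of genus $g\ge0$, with dual graph $G^*$ and positive coupling constants $(J_{e^*})_{e^*\in E^*}$. 1. The double Ising partition function can be rewritten as $$Z_{\mathrm{d\text{-}Ising}}(G^*,J)=\mathcal C_{\mathrm I}\sum_{\substack{(P,P^* )\in\mathcal P^0(G)\times\mathcal P^0(G^* )\\P\cap P^*=\emptyset}}\Bigl(\prod_{e\in P}\frac{2e^{-2J_{e^*}}}{1+e^{-4J_{e^*}}}\Bigr)\Bigl(\prod_{e^*\in P^*}\frac{1-e^{-4J_{e^*}}}{1+e^{-4J_{e^*}}}\Bigr),$$ where $\mathcal C_{\mathrm I}=2^{|V^*|+2g+1}\prod_{e\in E}\cosh(2J_{e^*})$. 2. For every polygon configuration $P\in\mathcal P^0(G)$, $$\mathbb P_{\mathrm{d\text{-}Ising}}[\mathrm{XOR}=P]=\frac{\displaystyle\Bigl(\prod_{e\in P}\frac{2e^{-2J_{e^*}}}{1+e^{-4J_{e^*}}}\Bigr)\sum_{\{P^*\in\mathcal P^0(G^* ):\,P\cap P^*=\emptyset\}}\Bigl(\prod_{e^*\in P^*}\frac{1-e^{-4J_{e^*}}}{1+e^{-4J_{e^*}}}\Bigr)}{\displaystyle\sum_{\substack{(Q,Q^* )\in\mathcal P^0(G)\times\mathcal P^0(G^* )\\Q\cap Q^*=\emptyset}}\Bigl(\prod_{e\in Q}\frac{2e^{-2J_{e^*}}}{1+e^{-4J_{e^*}}}\Bigr)\Bigl(\prod_{e^*\in 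Q^*}\frac{1-e^{-4J_{e^*}}}{1+e^{-4J_{e^*}}}\Bigr)}.$$
   Context: $G=(V,E)$, $G^*=(V^*,E^* )$, $e\mapsto e^*$ the bijection between edges and dual edges. A polygon configuration of $G$ (resp. $G^*$) is a subset of edges with even degree at every vertex; $\mathcal P^\epsilon(G)$ (resp. $\mathcal P^\epsilon(G^* )$) is the set of those with class $\epsilon\in H_1(\Sigma;\mathbb Z/2\mathbb Z)$. $P\cap P^*=\emptyset$ means there is no $e\in P$ with $e^*\in P^*$. Double Ising model: for each $\epsilon\in H_1(\Sigma;\mathbb Z/2\mathbb Z)$ fix a representative $\underline\epsilon\subset E$, with $s_\epsilon(e)=-1$ if $e\in\underline\epsilon$ and $1$ otherwise, and let $Z^\epsilon_{\mathrm{Ising}}(G^*,J)=\sum_{\sigma\in\{-1,1\}^{V^*}}\exp(\sum_{e^*=u^*v^*}s_\epsilon(e)J_{e^*}\sigma_{u^*}\sigma_{v^*})$. Then $Z_{\mathrm{d\text{-}Ising}}(G^*,J)=\sum_\epsilon (Z^\epsilon_{\mathrm{Ising}}(G^*,J))^2$. $\mathbb P_{\mathrm{d\text{-}Ising}}$ is the probability measure on $\bigcup_\epsilon\mathcal P^\epsilon(G)\times\mathcal P^\epsilon(G)$ giving $(P_{\mathrm{red}},P_{\mathrm{blue}})$ probability $(2\prod_{e\in E}e^{J_{e^*}})^2\prod_{e\in P_{\mathrm{red}}}e^{-2J_{e^*}}\prod_{e\in P_{\mathrm{blue}}}e^{-2J_{e^*}}/Z_{\mathrm{d\text{-}Ising}}(G^*,J)$.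 A pair in $\mathcal P^\epsilon(G)^2$ comes from spin configurations $\sigma,\sigma'$ (each unique up to global sign) with $P_{\mathrm{red}}=\{e:s_\epsilon(e)\sigma_{u^*}\sigma_{v^*}=-1,\ e^*=u^*v^*\}$ and similarly for $P_{\mathrm{blue}},\sigma'$. $\mathrm{XOR}(P_{\mathrm{red}},P_{\mathrm{blue}})$ is the set of edges $e$ of $G$ such that $\sigma\sigma'$ takes distinct values at the endpoints of $e^*$ (independent of choices). *)

theory Defs
  imports "HOL-Algebra.Coset" "HOL-Combinatorics.Orbits" "HOL-Probability.Probability_Measure"
begin

section \<open>Graphs cellularly embedded in closed oriented surfaces\<close>

text \<open>
  A finite graph (loops and multiple edges allowed) cellularly embedded in a compact connected
  oriented surface without boundary is encoded by its rotation system.  Each edge \<open>e\<close> carries the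
  two darts (oriented edges) \<open>(e, True)\<close> and \<open>(e, False)\<close>.  For a dart \<open>d\<close>, \<open>tail d\<close> is its origin,
  \<open>left d\<close> is the face on its left, and \<open>rot d\<close> is the next dart in counterclockwise order
  around \<open>tail d\<close>.
\<close>

record ('v, 'e, 'f) emb_graph =
  verts :: "'v set"
  edges :: "'e set"
  faces :: "'f set"
  tail :: "'e \<times> bool \<Rightarrow> 'v"
  left :: "'e \<times> bool \<Rightarrow> 'f"
  rot :: "'e \<times> bool \<Rightarrow> 'e \<times> bool"

definition darts :: "('v, 'e, 'f) emb_graph \<Rightarrow> ('e \<times> bool) set"
  where "darts M = edges M \<times> UNIV"

fun rev_dart :: "'e \<times> bool \<Rightarrow> 'e \<times> bool"
  where "rev_dart (e, b) = (e, \<not> b)"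

definition head :: "('v, 'e, 'f) emb_graph \<Rightarrow> 'e \<times> bool \<Rightarrow> 'v"
  where "head M d = tail M (rev_dart d)"

text \<open>
  \<open>face_rot M d\<close> is the dart following \<open>d\<close> on the boundary of the face to the left of \<open>d\<close>:
  arriving at the head of \<open>d\<close>, one leaves along the dart that precedes the reversal of \<open>d\<close>
  counterclockwise.
\<close>

definition face_rot :: "('v, 'e, 'f) emb_graph \<Rightarrow> 'e \<times> bool \<Rightarrow> 'e \<times> bool"
  where "face_rot M d = (if d \<in> darts M then inv_into UNIV (rot M) (rev_dart d) else d)"

text \<open>
  The vertices are the cycles of \<open>rot\<close> and the faces are the cycles of \<open>face_rot\<close>.  The only
  connected graph that has a vertex without darts is the single vertex without edges; it is
  cellularly embedded in the sphere only, with a single face, and is treated separately.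
  The genus is given by Euler's formula.
\<close>

locale cellular_embedding =
  fixes M :: "('v, 'e, 'f) emb_graph" and g :: nat
  assumes finite_edges: "finite (edges M)"
    and tail_verts: "tail M ` darts M \<subseteq> verts M"
    and left_faces: "left M ` darts M \<subseteq> faces M"
    and rot_permutes: "rot M permutes darts M"
    and vert_cyclic: "edges M \<noteq> {} \<Longrightarrow> v \<in> verts M \<Longrightarrow> cyclic_on (rot M) {d \<in> darts M. tail M d = v}"
    and face_cyclic: "edges M \<noteq> {} \<Longrightarrow> f \<in> faces M \<Longrightarrow> cyclic_on (face_rot M) {d \<in> darts M. left M d = f}"
    and verts_nonempty: "verts M \<noteq> {}"
    and graph_connected:
      "u \<in> verts M \<Longrightarrow> v \<in> verts M \<Longrightarrow> (u, v) \<in> {(tail M d, head M d) | d. d \<in> darts M}\<^sup>*"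
    and no_edges: "edges M = {} \<Longrightarrow> card (faces M) = 1"
    and euler: "int (card (verts M)) - int (card (edges M)) + int (card (faces M)) = 2 - 2 * int g"

text \<open>
  The dual graph.  The bijection \<open>e \<mapsto> e\<^sup>*\<close> is the identity on edge labels: the dual edge of \<open>e\<close>
  is again called \<open>e\<close>, now regarded as an edge of \<open>dual M\<close>.  The dual of a dart \<open>d\<close> crosses \<open>d\<close>
  from its left to its right, so the face of \<open>dual M\<close> on its left is the head of \<open>d\<close>.
\<close>

definition dual :: "('v, 'e, 'f) emb_graph \<Rightarrow> ('f, 'e, 'v) emb_graph"
  where "dual M = \<lparr>verts = faces M, edges = edges M, faces = verts M,
    tail = left M, left = head M, rot = face_rot M\<rparr>"

lemma rev_dart_simps [simp]: "rev_dart (rev_dart d) = d" "fst (rev_dart d) = fst d"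
  by (cases d; simp)+

lemma rev_dart_in_darts [simp]: "rev_dart d \<in> darts M \<longleftrightarrow> d \<in> darts M"
  by (cases d) (simp add: darts_def)

lemma dual_simps [simp]:
  "verts (dual M) = faces M" "edges (dual M) = edges M" "faces (dual M) = verts M"
  "tail (dual M) = left M" "left (dual M) = head M" "rot (dual M) = face_rot M"
  "darts (dual M) = darts M" "head (dual M) d = left M (rev_dart d)"
  by (simp_all add: dual_def darts_def head_def)

context cellular_embedding
begin

lemma finite_darts [simp]: "finite (darts M)"
  using finite_edges by (simp add: darts_def)

lemma rot_in: "d \<in> darts M \<Longrightarrow> rot M d \<in> darts M"
  using rot_permutes by (simp add: permutes_in_image)

lemma face_rot_permutes: "face_rot M permutes darts M"
proof -
  have inj: "inj_on (face_rot M) (darts M)"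
  proof (rule inj_onI)
    fix x y assume xy: "x \<in> darts M" "y \<in> darts M" "face_rot M x = face_rot M y"
    then have "rev_dart x = rev_dart y"
      using permutes_inverses(1)[OF rot_permutes] by (metis face_rot_def)
    then show "x = y" by (metis rev_dart_simps(1))
  qed
  have "face_rot M ` darts M \<subseteq> darts M"
    by (rule image_subsetI)
      (simp add: face_rot_def permutes_in_image[OF permutes_inv[OF rot_permutes]])
  then have "bij_betw (face_rot M) (darts M) (darts M)"
    using inj by (simp add: bij_betw_def endo_inj_surj)
  then show ?thesis by (rule bij_imp_permutes) (simp add: face_rot_def)
qed

lemma face_rot_dual: "d \<in> darts M \<Longrightarrow> face_rot (dual M) d = rev_dart (rot M (rev_dart d))"
proof -
  assume d: "d \<in> darts M"
  have "face_rot M (rev_dart (rot M (rev_dart d))) = rev_dart d"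
    using d rot_in by (simp add: face_rot_def permutes_inverses(2)[OF rot_permutes])
  then have "inv_into UNIV (face_rot M) (rev_dart d) = rev_dart (rot M (rev_dart d))"
    using face_rot_permutes by (metis permutes_inverses(2))
  then show ?thesis using d by (simp add: face_rot_def)
qed

lemma tail_in: "d \<in> darts M \<Longrightarrow> tail M d \<in> verts M" and left_in: "d \<in> darts M \<Longrightarrow> left M d \<in> faces M"
  using tail_verts left_faces by auto

lemma tail_rot: assumes d: "d \<in> darts M" shows "tail M (rot M d) = tail M d"
proof -
  have "edges M \<noteq> {}" using d by (auto simp: darts_def)
  from cyclic_on_inI[OF vert_cyclic[OF this tail_in[OF d]], of d] d show ?thesis by auto
qed

lemma left_face_rot: assumes d: "d \<in> darts M" shows "left M (face_rot M d) = left M d"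
proof -
  have "edges M \<noteq> {}" using d by (auto simp: darts_def)
  from cyclic_on_inI[OF face_cyclic[OF this left_in[OF d]], of d] d show ?thesis by auto
qed

lemma left_rev_rot: assumes d: "d \<in> darts M" shows "left M (rev_dart (rot M d)) = left M d"
proof -
  have "face_rot M (rev_dart (rot M d)) = d"
    using d rot_in by (simp add: face_rot_def permutes_inverses(2)[OF rot_permutes])
  then show ?thesis using left_face_rot[of "rev_dart (rot M d)"] d rot_in by simp
qed

lemma dual_cellular_embedding: "cellular_embedding (dual M) g"
proof
  show "finite (edges (dual M))" "tail (dual M) ` darts (dual M) \<subseteq> verts (dual M)"
    "left (dual M) ` darts (dual M) \<subseteq> faces (dual M)" "rot (dual M) permutes darts (dual M)"
    using finite_edges left_in face_rot_permutes
    by (auto simp: head_def simp del: rev_dart.simps intro!: tail_in)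
  show "cyclic_on (rot (dual M)) {d \<in> darts (dual M). tail (dual M) d = f}"
    if "edges (dual M) \<noteq> {}" "f \<in> verts (dual M)" for f
    using that face_cyclic by simp
  show "cyclic_on (face_rot (dual M)) {d \<in> darts (dual M). left (dual M) d = v}"
    if "edges (dual M) \<noteq> {}" "v \<in> faces (dual M)" for v
  proof -
    have "cyclic_on (face_rot (dual M)) (rev_dart ` {d \<in> darts M. tail M d = v})"
      by (rule cyclic_on_image[OF vert_cyclic]) (use that in \<open>auto simp: face_rot_dual\<close>)
    also have "rev_dart ` {d \<in> darts M. tail M d = v} = {d \<in> darts M. head M d = v}"
    proof (intro equalityI subsetI)
      fix d assume "d \<in> {d \<in> darts M. head M d = v}"
      then show "d \<in> rev_dart ` {d \<in> darts M. tail M d = v}"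
        by (intro image_eqI[of _ _ "rev_dart d"]) (auto simp: head_def)
    qed (auto simp: head_def simp del: rev_dart.simps)
    finally show ?thesis by simp
  qed
  show "verts (dual M) \<noteq> {}"
    using left_in no_edges by (cases "edges M = {}") (auto simp: darts_def)
  show "card (faces (dual M)) = 1" if "edges (dual M) = {}"
  proof -
    obtain v where v: "v \<in> verts M" using verts_nonempty by auto
    have "u = v" if "u \<in> verts M" for u
      using graph_connected[OF that v] \<open>edges (dual M) = {}\<close> by (auto simp: darts_def)
    with v have "verts M = {v}" by blast
    then show ?thesis by simp
  qed
  show "int (card (verts (dual M))) - int (card (edges (dual M))) + int (card (faces (dual M)))
      = 2 - 2 * int g"
    using euler by simp
  let ?R = "{(tail (dual M) d, head (dual M) d) | d. d \<in> darts (dual M)}"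
  have R: "(left M d, left M (rev_dart d)) \<in> ?R" if "d \<in> darts M" for d
    unfolding mem_Collect_eq using that by (intro exI[of _ d]) simp
  have same_tail: "(left M d, left M d') \<in> ?R\<^sup>*"
    if d: "d \<in> darts M" "d' \<in> darts M" "tail M d = tail M d'" for d d'
  proof -
    have ne: "edges M \<noteq> {}" using d by (auto simp: darts_def)
    have "d' \<in> {x \<in> darts M. tail M x = tail M d}" using d by simp
    also have "\<dots> = orbit (rot M) d"
      using orbit_cyclic_eq3[OF vert_cyclic[OF ne tail_in[OF d(1)]]] d by simp
    finally show ?thesis
    proof induct
      case base
      have "(left M (rev_dart (rot M d)), left M (rot M d)) \<in> ?R"
        using R[of "rev_dart (rot M d)"] d rot_in by simp
      then show ?case using d left_rev_rot by (simp add: r_into_rtrancl)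
    next
      case (step x)
      have x: "x \<in> darts M"
        using step(1) d permutes_orbit_subset[OF rot_permutes] by blast
      have "(left M (rev_dart (rot M x)), left M (rot M x)) \<in> ?R"
        using R[of "rev_dart (rot M x)"] x rot_in by simp
      then show ?case using rtrancl_into_rtrancl[OF step(2)] left_rev_rot[OF x] by simp
    qed
  qed
  have all: "\<forall>d\<in>darts M. \<forall>d'\<in>darts M. tail M d = u \<longrightarrow> tail M d' = v \<longrightarrow> (left M d, left M d') \<in> ?R\<^sup>*"
    if "(u, v) \<in> {(tail M d, head M d) | d. d \<in> darts M}\<^sup>*" for u v
    using that
  proof induct
    case base
    then show ?case using same_tail by auto
  next
    case (step w v)
    then obtain b where b: "b \<in> darts M" "tail M b = w" "head M b = v" by auto
    have e: "(left M b, left M (rev_dart b)) \<in> ?R\<^sup>*"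
      using R[OF b(1)] by (rule r_into_rtrancl)
    have "(left M d, left M d') \<in> ?R\<^sup>*"
      if d: "d \<in> darts M" "d' \<in> darts M" "tail M d = u" "tail M d' = v" for d d'
    proof -
      have "(left M d, left M b) \<in> ?R\<^sup>*" using step(3) d b by auto
      also note e
      also have "(left M (rev_dart b), left M d') \<in> ?R\<^sup>*"
        using same_tail[of "rev_dart b" d'] b d by (simp add: head_def)
      finally show ?thesis .
    qed
    then show ?case by blast
  qed
  show "(f, f') \<in> ?R\<^sup>*" if "f \<in> verts (dual M)" "f' \<in> verts (dual M)" for f f'
  proof (cases "edges M = {}")
    case True
    then show ?thesis using no_edges that by (auto simp: card_1_singleton_iff)
  next
    case False
    have "\<exists>d\<in>darts M. left M d = x" if "x \<in> faces M" for x
      using face_cyclic[OF False that] by (auto simp: cyclic_on_alldef)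
    then obtain d d' where d: "d \<in> darts M" "left M d = f" "d' \<in> darts M" "left M d' = f'"
      using \<open>f \<in> verts (dual M)\<close> \<open>f' \<in> verts (dual M)\<close> by (metis dual_simps(1))
    with all[OF graph_connected[OF tail_in tail_in]] show ?thesis by blast
  qed
qed

end

section \<open>Cellular homology with coefficients in Z/2Z\<close>

text \<open>Chains are subsets with symmetric difference as addition; a loop counts twice in a degree.\<close>

definition deg :: "('v, 'e, 'f) emb_graph \<Rightarrow> 'e set \<Rightarrow> 'v \<Rightarrow> nat"
  where "deg M P v = card {d \<in> darts M. fst d \<in> P \<and> tail M d = v}"

definition polygon_configs :: "('v, 'e, 'f) emb_graph \<Rightarrow> 'e set set"
  where "polygon_configs M = {P. P \<subseteq> edges M \<and> (\<forall>v \<in> verts M. even (deg M P v))}"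

definition cycle_group :: "('v, 'e, 'f) emb_graph \<Rightarrow> 'e set monoid"
  where "cycle_group M =
    \<lparr>carrier = polygon_configs M, monoid.mult = \<lambda>P Q. (P - Q) \<union> (Q - P), monoid.one = {}\<rparr>"

text \<open>The mod 2 boundary of a set of faces: the edges met an odd number of times.\<close>

definition face_boundary :: "('v, 'e, 'f) emb_graph \<Rightarrow> 'f set \<Rightarrow> 'e set"
  where "face_boundary M A = {e \<in> edges M. (left M (e, True) \<in> A) \<noteq> (left M (e, False) \<in> A)}"

definition boundaries :: "('v, 'e, 'f) emb_graph \<Rightarrow> 'e set set"
  where "boundaries M = face_boundary M ` Pow (faces M)"

definition H1 :: "('v, 'e, 'f) emb_graph \<Rightarrow> 'e set set monoid"
  where "H1 M = cycle_group M Mod boundaries M"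

definition hclass :: "('v, 'e, 'f) emb_graph \<Rightarrow> 'e set \<Rightarrow> 'e set set"
  where "hclass M P = boundaries M #>\<^bsub>cycle_group M\<^esub> P"

definition polygons :: "('v, 'e, 'f) emb_graph \<Rightarrow> 'e set set \<Rightarrow> 'e set set"
  where "polygons M \<epsilon> = {P \<in> polygon_configs M. hclass M P = \<epsilon>}"

abbreviation null_polygons :: "('v, 'e, 'f) emb_graph \<Rightarrow> 'e set set"
  where "null_polygons M \<equiv> polygons M \<one>\<^bsub>H1 M\<^esub>"

context cellular_embedding
begin

lemma polygon_configs_sym_diff:
  assumes "P \<in> polygon_configs M" "Q \<in> polygon_configs M"
  shows "(P - Q) \<union> (Q - P) \<in> polygon_configs M"
proof -
  have "even (deg M ((P - Q) \<union> (Q - P)) v)" if v: "v \<in> verts M" for v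
  proof -
    let ?D = "\<lambda>S. {d \<in> darts M. fst d \<in> S \<and> tail M d = v}"
    have fin: "finite (?D S)" for S by simp
    have "card (?D P) = card (?D (P - Q)) + card (?D (P \<inter> Q))"
      by (subst card_Un_disjoint[symmetric]) (auto intro: arg_cong[where f = card])
    moreover have "card (?D Q) = card (?D (Q - P)) + card (?D (P \<inter> Q))"
      by (subst card_Un_disjoint[symmetric]) (auto intro: arg_cong[where f = card])
    moreover have "card (?D ((P - Q) \<union> (Q - P))) = card (?D (P - Q)) + card (?D (Q - P))"
      by (subst card_Un_disjoint[symmetric]) (auto intro: arg_cong[where f = card])
    moreover have "even (card (?D P))" "even (card (?D Q))"
      using assms v by (auto simp: polygon_configs_def deg_def)
    ultimately show ?thesis unfolding deg_def by presburger
  qed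
  then show ?thesis using assms by (auto simp: polygon_configs_def)
qed

lemma cycle_group_comm_group: "comm_group (cycle_group M)"
proof (rule comm_groupI)
  show "\<one>\<^bsub>cycle_group M\<^esub> \<in> carrier (cycle_group M)"
    by (simp add: cycle_group_def polygon_configs_def deg_def)
  show "\<exists>y\<in>carrier (cycle_group M). y \<otimes>\<^bsub>cycle_group M\<^esub> x = \<one>\<^bsub>cycle_group M\<^esub>"
    if "x \<in> carrier (cycle_group M)" for x
    using that by (auto simp: cycle_group_def)
qed (auto simp: cycle_group_def intro: polygon_configs_sym_diff)

lemma boundaries_subset: "boundaries M \<subseteq> polygon_configs M"
proof -
  have "even (deg M (face_boundary M A) v)" if v: "v \<in> verts M" for A v
  proof (cases "edges M = {}")
    case True
    then show ?thesis by (simp add: deg_def darts_def)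
  next
    case False
    let ?S = "{d \<in> darts M. tail M d = v}"
    let ?L = "{d \<in> ?S. left M d \<in> A}" and ?R = "{d \<in> ?S. left M (rev_dart d) \<in> A}"
    have "bij_betw (rot M) ?L ?R"
    proof (rule bij_betw_imageI)
      show "inj_on (rot M) ?L" using permutes_inj_on[OF rot_permutes] .
      show "rot M ` ?L = ?R"
      proof (intro equalityI subsetI)
        fix d assume d: "d \<in> ?R"
        define c where "c = inv_into UNIV (rot M) d"
        have c: "rot M c = d" "c \<in> darts M"
          using d permutes_inverses(1)[OF rot_permutes]
            permutes_in_image[OF permutes_inv[OF rot_permutes]] by (auto simp: c_def)
        then have "c \<in> ?L" using d tail_rot[of c] left_rev_rot[of c] by auto
        then show "d \<in> rot M ` ?L" using c by auto
      qed (auto simp: rot_in tail_rot left_rev_rot)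
    qed
    then have "card ?L = card ?R" by (rule bij_betw_same_card)
    moreover have "card ?L = card (?L - ?R) + card (?L \<inter> ?R)"
      by (subst card_Un_disjoint[symmetric]) (auto intro: arg_cong[where f = card])
    moreover have "card ?R = card (?R - ?L) + card (?L \<inter> ?R)"
      by (subst card_Un_disjoint[symmetric]) (auto intro: arg_cong[where f = card])
    moreover have "{d \<in> darts M. fst d \<in> face_boundary M A \<and> tail M d = v} = (?L - ?R) \<union> (?R - ?L)"
      by (auto simp: face_boundary_def darts_def) (metis (full_types))+
    then have "deg M (face_boundary M A) v = card (?L - ?R) + card (?R - ?L)"
      unfolding deg_def by (simp only:) (subst card_Un_disjoint, auto)
    ultimately show ?thesis by presburger
  qed
  then show ?thesis by (auto simp: boundaries_def polygon_configs_def) (auto simp: face_boundary_def)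
qed

lemma boundaries_normal: "boundaries M \<lhd> cycle_group M"
proof -
  interpret C: comm_group "cycle_group M" by (rule cycle_group_comm_group)
  have inv: "inv\<^bsub>cycle_group M\<^esub> P = P" if "P \<in> polygon_configs M" for P
    using that by (intro C.inv_equality) (auto simp: cycle_group_def)
  have "subgroup (boundaries M) (cycle_group M)"
  proof
    show "boundaries M \<subseteq> carrier (cycle_group M)"
      using boundaries_subset by (simp add: cycle_group_def)
    show "\<one>\<^bsub>cycle_group M\<^esub> \<in> boundaries M"
      by (auto simp: cycle_group_def boundaries_def face_boundary_def intro!: image_eqI[of _ _ "{}"])
    show "inv\<^bsub>cycle_group M\<^esub> P \<in> boundaries M" if "P \<in> boundaries M" for P
      using that inv boundaries_subset by auto
    show "P \<otimes>\<^bsub>cycle_group M\<^esub> Q \<in> boundaries M"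
      if PQ: "P \<in> boundaries M" "Q \<in> boundaries M" for P Q
    proof -
      from PQ obtain A B where "P = face_boundary M A" "A \<subseteq> faces M"
        "Q = face_boundary M B" "B \<subseteq> faces M" by (auto simp: boundaries_def)
      then have "(P - Q) \<union> (Q - P) = face_boundary M ((A - B) \<union> (B - A))"
        "(A - B) \<union> (B - A) \<in> Pow (faces M)" by (auto simp: face_boundary_def)
      then show ?thesis by (auto simp: cycle_group_def boundaries_def)
    qed
  qed
  then show ?thesis by (simp add: C.subgroup_imp_normal)
qed

lemma H1_group: "group (H1 M)"
  unfolding H1_def using boundaries_normal by (rule normal.factorgroup_is_group)

end

section \<open>The double Ising model on the dual graph\<close>

text \<open>
  Here \<open>M\<close> is the primal graph, the spins live on the vertices of \<open>dual M\<close>, the coupling constant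
  of the dual edge of \<open>e\<close> is \<open>J e\<close>, and \<open>rep \<epsilon>\<close> is the representative chosen in the
  class \<open>\<epsilon>\<close>.
\<close>

definition edge_sign :: "'e set \<Rightarrow> 'e \<Rightarrow> real"
  where "edge_sign S e = (if e \<in> S then -1 else 1)"

definition spins :: "('v, 'e, 'f) emb_graph \<Rightarrow> ('v \<Rightarrow> real) set"
  where "spins M = verts M \<rightarrow>\<^sub>E {-1, 1}"

definition spin_product :: "('v, 'e, 'f) emb_graph \<Rightarrow> ('v \<Rightarrow> real) \<Rightarrow> 'e \<Rightarrow> real"
  where "spin_product M \<sigma> e = \<sigma> (tail M (e, True)) * \<sigma> (head M (e, True))"

definition Z_Ising ::
  "('v, 'e, 'f) emb_graph \<Rightarrow> ('e set set \<Rightarrow> 'e set) \<Rightarrow> ('e \<Rightarrow> real) \<Rightarrow> 'e set set \<Rightarrow> real"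
  where "Z_Ising M rep J \<epsilon> =
    (\<Sum>\<sigma>\<in>spins (dual M).
      exp (\<Sum>e\<in>edges (dual M). edge_sign (rep \<epsilon>) e * J e * spin_product (dual M) \<sigma> e))"

definition Z_dIsing ::
  "('v, 'e, 'f) emb_graph \<Rightarrow> ('e set set \<Rightarrow> 'e set) \<Rightarrow> ('e \<Rightarrow> real) \<Rightarrow> real"
  where "Z_dIsing M rep J = (\<Sum>\<epsilon>\<in>carrier (H1 M). (Z_Ising M rep J \<epsilon>)\<^sup>2)"

definition P_dIsing ::
  "('v, 'e, 'f) emb_graph \<Rightarrow> ('e set set \<Rightarrow> 'e set) \<Rightarrow> ('e \<Rightarrow> real) \<Rightarrow> ('e set \<times> 'e set) measure"
  where "P_dIsing M rep J =
    point_measure (\<Union>\<epsilon>\<in>carrier (H1 M). polygons M \<epsilon> \<times> polygons M \<epsilon>)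
      (\<lambda>(Pred, Pblue). ennreal
        ((2 * (\<Prod>e\<in>edges M. exp (J e)))\<^sup>2
          * (\<Prod>e\<in>Pred. exp (- 2 * J e)) * (\<Prod>e\<in>Pblue. exp (- 2 * J e)) / Z_dIsing M rep J))"

definition contour ::
  "('v, 'e, 'f) emb_graph \<Rightarrow> ('e set set \<Rightarrow> 'e set) \<Rightarrow> 'e set set \<Rightarrow> ('f \<Rightarrow> real) \<Rightarrow> 'e set"
  where "contour M rep \<epsilon> \<sigma> =
    {e \<in> edges M. edge_sign (rep \<epsilon>) e * spin_product (dual M) \<sigma> e = -1}"

lemma (in cellular_embedding) contour_surj:
  assumes "P \<in> polygon_configs M" and "rep (hclass M P) \<in> polygons M (hclass M P)"
  shows "\<exists>\<sigma>\<in>spins (dual M). contour M rep (hclass M P) \<sigma> = P"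
proof -
  define R where "R = rep (hclass M P)"
  have "{} \<in> boundaries M"
    by (auto simp: boundaries_def face_boundary_def intro!: image_eqI[of _ _ "{}"])
  then have "P \<in> hclass M P"
    unfolding hclass_def r_coset_def by (auto simp: cycle_group_def intro!: bexI[of _ "{}"])
  also have "hclass M P = hclass M R"
    using assms(2) by (simp add: polygons_def R_def)
  finally obtain A where A: "A \<subseteq> faces M" and
    P: "P = (face_boundary M A - R) \<union> (R - face_boundary M A)"
    by (auto simp: hclass_def r_coset_def cycle_group_def boundaries_def)
  define \<sigma> :: "'f \<Rightarrow> real" where "\<sigma> = (\<lambda>f\<in>faces M. if f \<in> A then -1 else 1)"
  have \<sigma>: "\<sigma> (left M (e, b)) = (if left M (e, b) \<in> A then -1 else 1)" if "e \<in> edges M" for e b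
    using that left_in[of "(e, b)"] by (simp add: \<sigma>_def darts_def)
  have "\<sigma> \<in> spins (dual M)" by (simp add: spins_def \<sigma>_def)
  moreover have "e \<in> contour M rep (hclass M P) \<sigma> \<longleftrightarrow> e \<in> P" for e
  proof (cases "e \<in> edges M")
    case True
    have "e \<in> P \<longleftrightarrow> (e \<in> face_boundary M A) \<noteq> (e \<in> R)"
      using P by blast
    also have "\<dots> \<longleftrightarrow> e \<in> contour M rep (hclass M P) \<sigma>"
      using True
      by (simp add: contour_def R_def[symmetric] spin_product_def edge_sign_def \<sigma> face_boundary_def)
    finally show ?thesis by simp
  next
    case False
    then show ?thesis using assms(1) by (auto simp: contour_def polygon_configs_def)
  qed
  then have "contour M rep (hclass M P) \<sigma> = P" by blast
  ultimately show ?thesis by blast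
qed

text \<open>The choice below is one of two opposite spin configurations.\<close>

definition spin_of ::
  "('v, 'e, 'f) emb_graph \<Rightarrow> ('e set set \<Rightarrow> 'e set) \<Rightarrow> 'e set \<Rightarrow> 'f \<Rightarrow> real"
  where "spin_of M rep P = (SOME \<sigma>. \<sigma> \<in> spins (dual M) \<and> contour M rep (hclass M P) \<sigma> = P)"

definition XOR ::
  "('v, 'e, 'f) emb_graph \<Rightarrow> ('e set set \<Rightarrow> 'e set) \<Rightarrow> 'e set \<times> 'e set \<Rightarrow> 'e set"
  where "XOR M rep = (\<lambda>(Pred, Pblue).
    let \<tau> = (\<lambda>f. spin_of M rep Pred f * spin_of M rep Pblue f)
    in {e \<in> edges M. \<tau> (tail (dual M) (e, True)) \<noteq> \<tau> (head (dual M) (e, True))})"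

end

theory Submission
  imports Defs
begin

text \<open>
  Chains modulo 2 are edge sets with symmetric difference as addition.  Write \<open>C\<close> for the group of
  polygon configurations of the primal graph, \<open>B \<subseteq> C\<close> for the boundaries of sets of faces, and
  \<open>B\<^sup>*\<close> for the boundaries of the dual graph; \<open>B\<close> and \<open>B\<^sup>*\<close> are the two sets of polygon
  configurations of class \<open>0\<close>.  Put \<open>x e = exp (- 2 * J e)\<close> and \<open>w P = (\<Prod>e\<in>P. x e)\<close>.

  In the low temperature expansion (\<open>Z_Ising_low_temperature\<close>), each polygon configuration of class
  \<open>\<epsilon>\<close> is the contour of exactly two opposite spin configurations, so that the double Ising
  partition function is \<open>(2 * (\<Prod>e\<in>edges M. exp (J e)))\<^sup>2\<close> times the sum of \<open>w P * w Q\<close> over all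
  homologous pairs \<open>(P, Q)\<close>.  On such a pair the two signs \<open>edge_sign (rep \<epsilon>) e\<close> multiply to \<open>1\<close>,
  hence \<open>XOR\<close> is the symmetric difference of \<open>P\<close> and \<open>Q\<close>, and it lies in \<open>B\<close>.  The pairs with a
  given \<open>XOR\<close> equal to \<open>S \<in> B\<close> are therefore parametrised by \<open>P \<in> C\<close>, with no condition on the class
  of \<open>P\<close>: the sum over classes in the definition of the double Ising model has disappeared.

  It remains to compute \<open>\<Sum>P\<in>C. w P * w (sym_diff P S)\<close>.  Each edge of \<open>S\<close> contributes \<open>x e\<close>
  whatever \<open>P\<close> is, and each edge of \<open>P - S\<close> contributes \<open>(x e)\<^sup>2\<close>.  Since \<open>C\<close> is the orthogonal
  complement of \<open>B\<^sup>*\<close> (\<open>polygon_configs_iff_orthogonal\<close>), Poisson summation over \<open>B\<^sup>*\<close>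
  (\<open>sum_polygon_configs\<close>) turns this into a sum over \<open>Q \<in> B\<^sup>*\<close> of products over the edges of
  \<open>1 + y e * edge_sign Q e\<close>, where \<open>y e = 1\<close> on \<open>S\<close> and \<open>y e = (x e)\<^sup>2\<close> elsewhere.  An edge in
  \<open>S \<inter> Q\<close> gives the factor \<open>0\<close>, which is the origin of the disjointness condition.  For \<open>Q\<close> disjoint
  from \<open>S\<close>, dividing the product by \<open>1 + (x e)\<^sup>2\<close> at every edge, and counting the factors \<open>x e\<close> of
  the edges of \<open>S\<close>, leaves the weights of the theorem on \<open>S\<close> and \<open>Q\<close> and \<open>1\<close> on all other edges
  (\<open>sum_shifted_polygon_configs\<close>).

  This gives both parts at once, up to the constant, which contains \<open>1 / card B\<^sup>*\<close>.  As the graph is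
  connected, only the empty set and the set of all vertices have an empty boundary in the dual,
  so that \<open>card B\<^sup>*\<close> is 2 to the power of the number of vertices minus 1, and Euler's formula gives
  the exponent in the theorem.
\<close>

section \<open>Products of signs and character sums modulo 2\<close>

lemma edge_sign_sym_diff: "edge_sign (sym_diff P Q) e = edge_sign P e * edge_sign Q e"
  by (auto simp: edge_sign_def)

lemma prod_edge_sign:
  assumes "finite P"
  shows "(\<Prod>e\<in>P. edge_sign Q e) = (-1) ^ card (P \<inter> Q)"
proof -
  have "(\<Prod>e\<in>P. edge_sign Q e) = (\<Prod>e\<in>P \<inter> Q. - 1)"
    unfolding edge_sign_def by (rule prod.inter_restrict[OF assms, symmetric])
  then show ?thesis by simp
qed

text \<open>
  Orthogonality of characters: \<open>Q \<mapsto> (-1) ^ card (P \<inter> Q)\<close> is multiplicative for the symmetric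
  difference.  If it takes the value \<open>-1\<close> at some \<open>R\<close>, translation by \<open>R\<close> changes the sign of the
  sum, which therefore vanishes.
\<close>

lemma character_sum:
  assumes "finite P" and closed: "\<And>Q R. Q \<in> \<B> \<Longrightarrow> R \<in> \<B> \<Longrightarrow> sym_diff Q R \<in> \<B>"
  shows "(\<Sum>Q\<in>\<B>. \<Prod>e\<in>P. edge_sign Q e) = (if \<forall>Q\<in>\<B>. even (card (P \<inter> Q)) then real (card \<B>) else 0)"
proof (cases "\<forall>Q\<in>\<B>. even (card (P \<inter> Q))")
  case True
  then show ?thesis by (simp add: prod_edge_sign[OF assms(1)])
next
  case False
  then obtain R where R: "R \<in> \<B>" "odd (card (P \<inter> R))" by blast
  let ?s = "\<lambda>Q. \<Prod>e\<in>P. edge_sign Q e"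
  have shift: "?s (sym_diff Q R) = - ?s Q" for Q
    using R(2) by (simp add: edge_sign_sym_diff prod.distrib) (simp add: prod_edge_sign[OF assms(1)])
  have cancel: "sym_diff (sym_diff Q R) R = Q" for Q by blast
  have "(\<Sum>Q\<in>\<B>. ?s Q) = (\<Sum>Q\<in>\<B>. ?s (sym_diff Q R))"
    by (rule sum.reindex_bij_witness[of _ "\<lambda>Q. sym_diff Q R" "\<lambda>Q. sym_diff Q R"])
      (simp_all only: cancel closed R(1))
  also have "\<dots> = - (\<Sum>Q\<in>\<B>. ?s Q)" by (simp only: shift sum_negf)
  finally show ?thesis unfolding if_not_P[OF False] by simp
qed

section \<open>Boundaries and homology classes\<close>

lemma face_boundary_subset: "face_boundary M A \<subseteq> edges M"
  by (auto simp: face_boundary_def)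

lemma face_boundary_sym_diff:
  "face_boundary M (sym_diff A B) = sym_diff (face_boundary M A) (face_boundary M B)"
  by (auto simp: face_boundary_def)

lemma boundaries_sym_diff:
  assumes "P \<in> boundaries M" "Q \<in> boundaries M"
  shows "sym_diff P Q \<in> boundaries M"
proof -
  from assms obtain A B where "A \<subseteq> faces M" "B \<subseteq> faces M"
    "P = face_boundary M A" "Q = face_boundary M B"
    by (auto simp: boundaries_def)
  then show ?thesis
    unfolding boundaries_def
    by (intro image_eqI[of _ _ "sym_diff A B"]) (auto simp: face_boundary_sym_diff simp del: Un_iff)
qed

lemma empty_boundary: "{} \<in> boundaries M"
  by (auto simp: boundaries_def face_boundary_def intro!: image_eqI[of _ _ "{}"])

lemma hclass_eq_image: "hclass M P = (\<lambda>b. sym_diff b P) ` boundaries M"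
  by (auto simp: hclass_def r_coset_def cycle_group_def)

lemma hclass_eq_iff: "hclass M P = hclass M Q \<longleftrightarrow> sym_diff P Q \<in> boundaries M"
proof
  assume "hclass M P = hclass M Q"
  moreover have "P \<in> hclass M P"
    unfolding hclass_eq_image using empty_boundary by (intro image_eqI[of _ _ "{}"]) auto
  ultimately obtain b where b: "b \<in> boundaries M" "P = sym_diff b Q"
    by (auto simp: hclass_eq_image)
  have "sym_diff P Q = b" unfolding b(2) by blast
  then show "sym_diff P Q \<in> boundaries M" using b(1) by simp
next
  have sub: "hclass M P \<subseteq> hclass M Q" if "sym_diff P Q \<in> boundaries M" for P Q
  proof
    fix X assume "X \<in> hclass M P"
    then obtain b where b: "b \<in> boundaries M" "X = sym_diff b P" by (auto simp: hclass_eq_image)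
    then have "X = sym_diff (sym_diff b (sym_diff P Q)) Q" by blast
    then show "X \<in> hclass M Q"
      unfolding hclass_eq_image using boundaries_sym_diff[OF b(1) that] by (rule image_eqI)
  qed
  assume *: "sym_diff P Q \<in> boundaries M"
  moreover have "sym_diff Q P = sym_diff P Q" by blast
  ultimately show "hclass M P = hclass M Q" using sub[OF *] sub[of Q P] by simp
qed

context cellular_embedding
begin

lemma carrier_H1: "carrier (H1 M) = hclass M ` polygon_configs M"
  by (simp add: H1_def carrier_FactGroup cycle_group_def hclass_def[abs_def])

lemma hclass_empty: "hclass M {} = \<one>\<^bsub>H1 M\<^esub>"
  by (simp add: hclass_eq_image H1_def)

lemma null_polygons_eq_boundaries: "null_polygons M = boundaries M"
  using boundaries_subset
  by (auto simp: polygons_def hclass_empty[symmetric] hclass_eq_iff simp del: Un_iff)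

lemma finite_polygon_configs: "finite (polygon_configs M)"
  by (rule finite_subset[OF _ finite_Pow_iff[THEN iffD2, OF finite_edges]])
    (auto simp: polygon_configs_def)

lemma finite_boundaries: "finite (boundaries M)"
  using finite_polygon_configs boundaries_subset by (rule rev_finite_subset)

lemma finite_faces: "finite (faces M)"
proof (cases "edges M = {}")
  case True
  then show ?thesis using no_edges by (intro card_ge_0_finite) simp
next
  case False
  have "faces M \<subseteq> left M ` darts M"
    using face_cyclic[OF False] by (fastforce simp: cyclic_on_alldef)
  then show ?thesis by (rule finite_subset) simp
qed

lemma faces_nonempty: "faces M \<noteq> {}"
  using cellular_embedding.verts_nonempty[OF dual_cellular_embedding] by simp

text \<open>
  A set of faces without boundary contains with each face all its neighbours; the dual graph is
  connected.
\<close>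

lemma face_boundary_empty_iff:
  assumes "A \<subseteq> faces M"
  shows "face_boundary M A = {} \<longleftrightarrow> A = {} \<or> A = faces M"
proof
  assume empty: "face_boundary M A = {}"
  have step: "left M d \<in> A \<longleftrightarrow> left M (rev_dart d) \<in> A" if "d \<in> darts M" for d
  proof -
    obtain e b where d: "d = (e, b)" by (cases d)
    then have "e \<in> edges M" using that by (simp add: darts_def)
    then show ?thesis using empty d by (cases b) (auto simp: face_boundary_def)
  qed
  let ?R = "{(tail (dual M) d, head (dual M) d) | d. d \<in> darts (dual M)}"
  have "f' \<in> A" if "f \<in> A" "(f, f') \<in> ?R\<^sup>*" for f f'
    using that(2,1) by induct (auto simp: step[symmetric] simp del: rev_dart.simps)
  then have "f' \<in> A" if "f \<in> A" "f' \<in> faces M" for f f'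
    using cellular_embedding.graph_connected[OF dual_cellular_embedding, of f f'] that assms
    by (auto simp del: dual_simps(7))
  then show "A = {} \<or> A = faces M" using assms by blast
next
  assume "A = {} \<or> A = faces M"
  then show "face_boundary M A = {}"
    using left_in by (auto simp: face_boundary_def darts_def)
qed

lemma face_boundary_eq_iff:
  assumes "A \<subseteq> faces M" "B \<subseteq> faces M"
  shows "face_boundary M A = face_boundary M B \<longleftrightarrow> A = B \<or> A = faces M - B"
proof -
  have "face_boundary M A = face_boundary M B \<longleftrightarrow> face_boundary M (sym_diff A B) = {}"
    unfolding face_boundary_sym_diff by blast
  also have "\<dots> \<longleftrightarrow> sym_diff A B = {} \<or> sym_diff A B = faces M"
    using assms by (intro face_boundary_empty_iff) blast
  also have "\<dots> \<longleftrightarrow> A = B \<or> A = faces M - B" using assms by blast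
  finally show ?thesis .
qed

text \<open>
  The boundary map is two-to-one, because the only other set of faces with the boundary of \<open>B\<close> is
  the complement of \<open>B\<close>.  This is used on both sides of the duality: for \<open>M\<close> it says that a contour
  comes from two opposite spin configurations, and for the dual of \<open>M\<close> it counts the boundaries.
\<close>

lemma sum_face_boundary:
  fixes h :: "'e set \<Rightarrow> real"
  shows "(\<Sum>A\<in>Pow (faces M). h (face_boundary M A)) = 2 * (\<Sum>b\<in>boundaries M. h b)"
proof -
  have fibre: "card {A \<in> Pow (faces M). face_boundary M A = b} = 2" if "b \<in> boundaries M" for b
  proof -
    from that obtain B where B: "B \<subseteq> faces M" "b = face_boundary M B"
      by (auto simp: boundaries_def)
    have "{A \<in> Pow (faces M). face_boundary M A = b} = {A \<in> Pow (faces M). A = B \<or> A = faces M - B}"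
      using face_boundary_eq_iff[OF _ B(1)] by (intro Collect_cong conj_cong) (simp_all add: B(2))
    also have "\<dots> = {B, faces M - B}" using B(1) by auto
    finally have "{A \<in> Pow (faces M). face_boundary M A = b} = {B, faces M - B}" .
    moreover have "B \<noteq> faces M - B" using faces_nonempty B(1) by blast
    ultimately show ?thesis by simp
  qed
  have "(\<Sum>A\<in>Pow (faces M). h (face_boundary M A))
      = (\<Sum>b\<in>boundaries M. \<Sum>A | A \<in> Pow (faces M) \<and> face_boundary M A = b. h (face_boundary M A))"
    unfolding boundaries_def using finite_faces by (intro sum.image_gen) simp
  also have "\<dots> = (\<Sum>b\<in>boundaries M. 2 * h b)"
  proof (rule sum.cong[OF refl])
    fix b assume b: "b \<in> boundaries M"
    have "(\<Sum>A | A \<in> Pow (faces M) \<and> face_boundary M A = b. h (face_boundary M A))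
        = (\<Sum>A | A \<in> Pow (faces M) \<and> face_boundary M A = b. h b)"
      by (rule sum.cong) auto
    then show "(\<Sum>A | A \<in> Pow (faces M) \<and> face_boundary M A = b. h (face_boundary M A)) = 2 * h b"
      using fibre[OF b] by simp
  qed
  finally show ?thesis by (simp add: sum_distrib_left)
qed

lemma card_boundaries: "2 * card (boundaries M) = 2 ^ card (faces M)"
proof -
  have "real (2 * card (boundaries M)) = real (2 ^ card (faces M))"
    using sum_face_boundary[of "\<lambda>_. 1"] finite_faces by (simp add: card_Pow)
  then show ?thesis by (simp only: of_nat_eq_iff)
qed

section \<open>Duality between cycles and boundaries\<close>

text \<open>
  Both sides have the parity of the number of darts over \<open>P\<close> that start in \<open>A\<close>: an edge has exactly
  one such dart if and only if it belongs to the dual boundary of \<open>A\<close>.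
\<close>

lemma even_card_inter_face_boundary_dual:
  assumes "P \<subseteq> edges M" "A \<subseteq> verts M" "finite A"
  shows "even (card (P \<inter> face_boundary (dual M) A)) \<longleftrightarrow> even (\<Sum>v\<in>A. deg M P v)"
proof -
  have finP: "finite P" using assms(1) finite_edges by (rule finite_subset)
  let ?D = "{d \<in> darts M. fst d \<in> P \<and> tail M d \<in> A}"
  let ?T = "\<lambda>b. {e \<in> P. tail M (e, b) \<in> A}"
  have "(\<Sum>v\<in>A. deg M P v) = (\<Sum>v\<in>A. card {d \<in> ?D. tail M d = v})"
    unfolding deg_def by (intro sum.cong refl arg_cong[where f = card]) auto
  also have "\<dots> = card ?D"
    using sum.group[of ?D A "tail M" "\<lambda>_. 1::nat"] assms(3) by auto
  also have "?D = (\<lambda>e. (e, True)) ` ?T True \<union> (\<lambda>e. (e, False)) ` ?T False"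
    using assms(1) by (auto simp: darts_def image_iff) (metis (full_types))+
  also have "card \<dots> = card (?T True) + card (?T False)"
    using finP by (subst card_Un_disjoint) (auto simp: card_image inj_on_def)
  finally have *: "(\<Sum>v\<in>A. deg M P v) = card (?T True) + card (?T False)" .
  have "card (?T True) = card (?T True - ?T False) + card (?T True \<inter> ?T False)"
    "card (?T False) = card (?T False - ?T True) + card (?T True \<inter> ?T False)"
    using finP by (subst card_Un_disjoint[symmetric]; auto intro: arg_cong[where f = card])+
  moreover have "P \<inter> face_boundary (dual M) A = (?T True - ?T False) \<union> (?T False - ?T True)"
    using assms(1) by (auto simp: face_boundary_def head_def)
  then have "card (P \<inter> face_boundary (dual M) A)
      = card (?T True - ?T False) + card (?T False - ?T True)"
    using finP by (simp only:) (subst card_Un_disjoint, auto)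
  ultimately show ?thesis using * by presburger
qed

lemma finite_verts: "finite (verts M)"
  using cellular_embedding.finite_faces[OF dual_cellular_embedding] by simp

text \<open>
  The degree condition at a vertex \<open>v\<close> is orthogonality to the dual boundary of \<open>{v}\<close>, and these
  boundaries generate all the others.
\<close>

lemma polygon_configs_iff_orthogonal:
  assumes "P \<subseteq> edges M"
  shows "P \<in> polygon_configs M \<longleftrightarrow> (\<forall>Q\<in>boundaries (dual M). even (card (P \<inter> Q)))"
proof
  assume "P \<in> polygon_configs M"
  then have "even (\<Sum>v\<in>A. deg M P v)" if "A \<subseteq> verts M" for A
    using that by (intro dvd_sum) (auto simp: polygon_configs_def)
  then show "\<forall>Q\<in>boundaries (dual M). even (card (P \<inter> Q))"
    using even_card_inter_face_boundary_dual[OF assms] finite_subset[OF _ finite_verts]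
    by (auto simp: boundaries_def)
next
  assume orth: "\<forall>Q\<in>boundaries (dual M). even (card (P \<inter> Q))"
  have "even (deg M P v)" if v: "v \<in> verts M" for v
    using even_card_inter_face_boundary_dual[OF assms, of "{v}"] orth v
    by (auto simp: boundaries_def)
  then show "P \<in> polygon_configs M" using assms by (simp add: polygon_configs_def)
qed

text \<open>
  Poisson summation (the MacWilliams identity): expand the products on the right over the subsets
  \<open>P\<close> of the edges; the sum over \<open>Q\<close> is then a character sum, which selects the polygon
  configurations among all \<open>P\<close>.
\<close>

lemma sum_polygon_configs:
  fixes y :: "'e \<Rightarrow> real"
  shows "card (boundaries (dual M)) * (\<Sum>P\<in>polygon_configs M. \<Prod>e\<in>P. y e)
    = (\<Sum>Q\<in>boundaries (dual M). \<Prod>e\<in>edges M. 1 + y e * edge_sign Q e)"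
proof -
  let ?B = "boundaries (dual M)"
  have char: "(\<Sum>Q\<in>?B. \<Prod>e\<in>P. edge_sign Q e) = (if P \<in> polygon_configs M then real (card ?B) else 0)"
    if "P \<in> Pow (edges M)" for P
  proof -
    have P: "P \<subseteq> edges M" using that by simp
    show ?thesis
      unfolding polygon_configs_iff_orthogonal[OF P]
      by (rule character_sum[OF finite_subset[OF P finite_edges]]) (rule boundaries_sym_diff)
  qed
  have "(\<Sum>Q\<in>?B. \<Prod>e\<in>edges M. 1 + y e * edge_sign Q e)
      = (\<Sum>Q\<in>?B. \<Sum>P\<in>Pow (edges M). (\<Prod>e\<in>P. y e) * (\<Prod>e\<in>P. edge_sign Q e))"
    using prod_add[OF finite_edges, of "\<lambda>e. y e * edge_sign Q e" "\<lambda>_. 1" for Q]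
    by (simp add: add.commute prod.distrib)
  also have "\<dots> = (\<Sum>P\<in>Pow (edges M). (\<Prod>e\<in>P. y e) * (\<Sum>Q\<in>?B. \<Prod>e\<in>P. edge_sign Q e))"
    by (subst sum.swap) (simp add: sum_distrib_left)
  also have "\<dots> = (\<Sum>P\<in>Pow (edges M). if P \<in> polygon_configs M then card ?B * (\<Prod>e\<in>P. y e) else 0)"
    using char by (intro sum.cong) auto
  also have "\<dots> = (\<Sum>P\<in>Pow (edges M) \<inter> polygon_configs M. card ?B * (\<Prod>e\<in>P. y e))"
    using finite_edges by (simp add: sum.inter_restrict)
  also have "Pow (edges M) \<inter> polygon_configs M = polygon_configs M"
    by (auto simp: polygon_configs_def)
  finally show ?thesis by (simp add: sum_distrib_left)
qed

text \<open>
  The duality behind both parts of the theorem.  It is Poisson summation for the weights \<open>1\<close> on \<open>S\<close>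
  and \<open>(x e)\<^sup>2\<close> off \<open>S\<close>; the factor \<open>1 + 1 * (- 1) = 0\<close> at an edge of \<open>S \<inter> Q\<close> leaves only the
  \<open>Q\<close> disjoint from \<open>S\<close>.
\<close>

lemma sum_shifted_polygon_configs:
  fixes x :: "'e \<Rightarrow> real"
  assumes S: "S \<subseteq> edges M"
  shows "card (boundaries (dual M)) * (\<Sum>P\<in>polygon_configs M. prod x P * prod x (sym_diff P S))
    = (\<Prod>e\<in>edges M. 1 + (x e)\<^sup>2) * ((\<Prod>e\<in>S. 2 * x e / (1 + (x e)\<^sup>2)) *
      (\<Sum>Q | Q \<in> boundaries (dual M) \<and> S \<inter> Q = {}. \<Prod>e\<in>Q. (1 - (x e)\<^sup>2) / (1 + (x e)\<^sup>2)))"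
proof -
  let ?B = "boundaries (dual M)"
  define y where "y e = (if e \<in> S then 1 else (x e)\<^sup>2)" for e
  have pos: "1 + (x e)\<^sup>2 \<noteq> 0" for e by (metis add_pos_nonneg zero_le_power2 zero_less_one less_irrefl)
  have fin: "finite P" if "P \<subseteq> edges M" for P using that finite_edges by (rule finite_subset)
  have restrict: "prod f P = (\<Prod>e\<in>edges M. if e \<in> P then f e else 1)" if "P \<subseteq> edges M"
    for f :: "'e \<Rightarrow> real" and P
    using that prod.inter_restrict[OF finite_edges, of f P] by (simp add: Int_absorb1)
  \<comment> \<open>An edge of \<open>S\<close> lies in exactly one of \<open>P\<close> and \<open>sym_diff P S\<close>, any other edge in both or none.\<close>
  have pair: "prod x P * prod x (sym_diff P S) = prod x S * prod y P" if P: "P \<subseteq> edges M" for P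
  proof -
    have "sym_diff P S \<subseteq> edges M" using P S by blast
    then show ?thesis
      unfolding restrict[OF P] restrict[OF S] restrict[OF \<open>sym_diff P S \<subseteq> edges M\<close>]
        prod.distrib[symmetric]
      by (intro prod.cong) (auto simp: y_def power2_eq_square)
  qed
  have factor: "prod x S * (\<Prod>e\<in>edges M. 1 + y e * edge_sign Q e) = (if S \<inter> Q = {} then
      (\<Prod>e\<in>edges M. 1 + (x e)\<^sup>2) * (\<Prod>e\<in>S. 2 * x e / (1 + (x e)\<^sup>2)) *
        (\<Prod>e\<in>Q. (1 - (x e)\<^sup>2) / (1 + (x e)\<^sup>2)) else 0)" if Q: "Q \<subseteq> edges M" for Q
  proof (cases "S \<inter> Q = {}")
    case True
    then show ?thesis
      unfolding restrict[OF Q] restrict[OF S]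
      by (simp add: prod.distrib[symmetric] del: prod.distrib)
        (intro prod.cong, use pos in \<open>auto simp: y_def edge_sign_def\<close>)
  next
    case False
    then obtain e where "e \<in> S" "e \<in> Q" by blast
    then have "e \<in> edges M" "1 + y e * edge_sign Q e = 0"
      using S by (auto simp: y_def edge_sign_def)
    then have "(\<Prod>e\<in>edges M. 1 + y e * edge_sign Q e) = 0"
      by (intro prod_zero[OF finite_edges] bexI)
    then show ?thesis using False by simp
  qed
  have "card ?B * (\<Sum>P\<in>polygon_configs M. prod x P * prod x (sym_diff P S))
      = prod x S * (card ?B * (\<Sum>P\<in>polygon_configs M. prod y P))"
  proof -
    have "(\<Sum>P\<in>polygon_configs M. prod x P * prod x (sym_diff P S))
        = (\<Sum>P\<in>polygon_configs M. prod x S * prod y P)"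
      by (rule sum.cong[OF refl], rule pair) (auto simp: polygon_configs_def)
    then show ?thesis by (simp add: sum_distrib_left[symmetric])
  qed
  also have "\<dots> = (\<Sum>Q\<in>?B. prod x S * (\<Prod>e\<in>edges M. 1 + y e * edge_sign Q e))"
    unfolding sum_polygon_configs by (rule sum_distrib_left)
  also have "\<dots> = (\<Sum>Q\<in>?B. if S \<inter> Q = {} then
      (\<Prod>e\<in>edges M. 1 + (x e)\<^sup>2) * (\<Prod>e\<in>S. 2 * x e / (1 + (x e)\<^sup>2)) *
        (\<Prod>e\<in>Q. (1 - (x e)\<^sup>2) / (1 + (x e)\<^sup>2)) else 0)"
    by (rule sum.cong[OF refl], rule factor) (auto simp: boundaries_def face_boundary_def)
  also have "\<dots> = (\<Sum>Q | Q \<in> ?B \<and> S \<inter> Q = {}.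
      (\<Prod>e\<in>edges M. 1 + (x e)\<^sup>2) * (\<Prod>e\<in>S. 2 * x e / (1 + (x e)\<^sup>2)) *
        (\<Prod>e\<in>Q. (1 - (x e)\<^sup>2) / (1 + (x e)\<^sup>2)))"
    using cellular_embedding.finite_boundaries[OF dual_cellular_embedding]
    by (simp add: sum.inter_filter)
  finally show ?thesis by (simp add: sum_distrib_left mult.assoc)
qed

end

section \<open>Spin configurations and their contours\<close>

text \<open>
  The function is restricted to the faces in order to belong to the extensional function space
  \<open>spins (dual M)\<close>.
\<close>

definition spin_config :: "('v, 'e, 'f) emb_graph \<Rightarrow> 'f set \<Rightarrow> 'f \<Rightarrow> real"
  where "spin_config M A = (\<lambda>f\<in>faces M. if f \<in> A then - 1 else 1)"

lemma spin_product_cases: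
  assumes "\<sigma> \<in> spins (dual M)" "left M (e, True) \<in> faces M" "left M (e, False) \<in> faces M"
  shows "spin_product (dual M) \<sigma> e = 1 \<or> spin_product (dual M) \<sigma> e = - 1"
proof -
  have "\<sigma> f = 1 \<or> \<sigma> f = -1" if "f \<in> faces M" for f
    using PiE_mem[OF assms(1)[unfolded spins_def], of f] that by auto
  from this[OF assms(2)] this[OF assms(3)] show ?thesis
    by (auto simp: spin_product_def)
qed

lemma bij_betw_spin_config: "bij_betw (spin_config M) (Pow (faces M)) (spins (dual M))"
proof (rule bij_betwI[where g = "\<lambda>\<sigma>. {f \<in> faces M. \<sigma> f = - 1}"])
  show "spin_config M \<in> Pow (faces M) \<rightarrow> spins (dual M)"
    by (simp add: spin_config_def spins_def)
  show "(\<lambda>\<sigma>. {f \<in> faces M. \<sigma> f = - 1}) \<in> spins (dual M) \<rightarrow> Pow (faces M)" by blast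
  show "{f \<in> faces M. spin_config M A f = - 1} = A" if "A \<in> Pow (faces M)" for A
  proof -
    have "spin_config M A f = - 1 \<longleftrightarrow> f \<in> A" if "f \<in> faces M" for f
      using that by (simp add: spin_config_def)
    then show ?thesis using that by blast
  qed
  show "spin_config M {f \<in> faces M. \<sigma> f = - 1} = \<sigma>" if "\<sigma> \<in> spins (dual M)" for \<sigma>
  proof
    fix f
    have \<sigma>: "\<sigma> \<in> faces M \<rightarrow>\<^sub>E {- 1, 1}" using that by (simp add: spins_def)
    show "spin_config M {f \<in> faces M. \<sigma> f = - 1} f = \<sigma> f"
    proof (cases "f \<in> faces M")
      case True
      then have "\<sigma> f = - 1 \<or> \<sigma> f = 1" using PiE_mem[OF \<sigma>] by blast
      then show ?thesis using True by (auto simp: spin_config_def)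
    next
      case False
      then show ?thesis using PiE_arb[OF \<sigma>] by (simp add: spin_config_def)
    qed
  qed
qed

context cellular_embedding
begin

lemma left_pair_in: "e \<in> edges M \<Longrightarrow> left M (e, b) \<in> faces M"
  using left_in[of "(e, b)"] by (simp add: darts_def)

lemma contour_spin_config:
  assumes "rep \<epsilon> \<subseteq> edges M"
  shows "contour M rep \<epsilon> (spin_config M A) = sym_diff (face_boundary M A) (rep \<epsilon>)"
proof (rule Set.set_eqI)
  fix e
  show "e \<in> contour M rep \<epsilon> (spin_config M A) \<longleftrightarrow> e \<in> sym_diff (face_boundary M A) (rep \<epsilon>)"
  proof (cases "e \<in> edges M")
    case True
    then show ?thesis
      by (simp add: contour_def spin_config_def spin_product_def face_boundary_def edge_sign_def
          left_pair_in)
  next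
    case False
    then show ?thesis using assms by (auto simp: contour_def face_boundary_def)
  qed
qed

text \<open>
  Contours in the class \<open>\<epsilon>\<close> are the translates of boundaries by the representative of \<open>\<epsilon>\<close>, so this
  is the two-to-one property of the boundary map.
\<close>

lemma sum_contour:
  fixes h :: "'e set \<Rightarrow> real"
  assumes rep: "rep \<epsilon> \<in> polygons M \<epsilon>"
  shows "(\<Sum>\<sigma>\<in>spins (dual M). h (contour M rep \<epsilon> \<sigma>)) = 2 * (\<Sum>P\<in>polygons M \<epsilon>. h P)"
proof -
  from rep have R: "rep \<epsilon> \<in> polygon_configs M" "rep \<epsilon> \<subseteq> edges M" "hclass M (rep \<epsilon>) = \<epsilon>"
    by (auto simp: polygons_def polygon_configs_def)
  have "(\<Sum>\<sigma>\<in>spins (dual M). h (contour M rep \<epsilon> \<sigma>))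
      = (\<Sum>A\<in>Pow (faces M). h (contour M rep \<epsilon> (spin_config M A)))"
    by (rule sum.reindex_bij_betw[OF bij_betw_spin_config, symmetric])
  also have "\<dots> = (\<Sum>A\<in>Pow (faces M). h (sym_diff (face_boundary M A) (rep \<epsilon>)))"
    by (simp only: contour_spin_config[of rep, OF R(2)])
  also have "\<dots> = 2 * (\<Sum>b\<in>boundaries M. h (sym_diff b (rep \<epsilon>)))"
    by (rule sum_face_boundary[of "\<lambda>b. h (sym_diff b (rep \<epsilon>))"])
  also have "(\<Sum>b\<in>boundaries M. h (sym_diff b (rep \<epsilon>))) = (\<Sum>P\<in>polygons M \<epsilon>. h P)"
  proof (rule sum.reindex_bij_witness[of _ "\<lambda>P. sym_diff P (rep \<epsilon>)" "\<lambda>b. sym_diff b (rep \<epsilon>)"])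
    have cancel: "sym_diff (sym_diff P (rep \<epsilon>)) (rep \<epsilon>) = P" for P by blast
    show "sym_diff (sym_diff P (rep \<epsilon>)) (rep \<epsilon>) = P" for P by (fact cancel)
    show "sym_diff (sym_diff P (rep \<epsilon>)) (rep \<epsilon>) = P" for P by (fact cancel)
    show "sym_diff P (rep \<epsilon>) \<in> boundaries M" if "P \<in> polygons M \<epsilon>" for P
      using that R(3) hclass_eq_iff[of M P "rep \<epsilon>"] by (simp add: polygons_def)
    show "sym_diff b (rep \<epsilon>) \<in> polygons M \<epsilon>" if "b \<in> boundaries M" for b
    proof -
      have "hclass M (sym_diff b (rep \<epsilon>)) = \<epsilon>"
        using that R(3) hclass_eq_iff[of M "sym_diff b (rep \<epsilon>)" "rep \<epsilon>"] by (simp only: cancel)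
      then show ?thesis
        using polygon_configs_sym_diff[OF _ R(1), of b] that boundaries_subset
        by (auto simp: polygons_def)
    qed
  qed simp
  finally show ?thesis .
qed

text \<open>
  Relative to the weight \<open>exp (J e)\<close> of an edge with positive signed spin product, an edge of the
  contour costs the factor \<open>exp (- 2 * J e)\<close>.
\<close>

lemma Z_Ising_low_temperature:
  assumes rep: "rep \<epsilon> \<in> polygons M \<epsilon>"
  shows "Z_Ising M rep J \<epsilon> =
    2 * (\<Prod>e\<in>edges M. exp (J e)) * (\<Sum>P\<in>polygons M \<epsilon>. \<Prod>e\<in>P. exp (- 2 * J e))"
proof -
  have "exp (\<Sum>e\<in>edges (dual M). edge_sign (rep \<epsilon>) e * J e * spin_product (dual M) \<sigma> e)
      = (\<Prod>e\<in>edges M. exp (J e)) * (\<Prod>e\<in>contour M rep \<epsilon> \<sigma>. exp (- 2 * J e))"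
    if \<sigma>: "\<sigma> \<in> spins (dual M)" for \<sigma>
  proof -
    have "exp (\<Sum>e\<in>edges (dual M). edge_sign (rep \<epsilon>) e * J e * spin_product (dual M) \<sigma> e)
        = (\<Prod>e\<in>edges M. exp (edge_sign (rep \<epsilon>) e * J e * spin_product (dual M) \<sigma> e))"
      using finite_edges by (simp add: exp_sum)
    also have "\<dots> = (\<Prod>e\<in>edges M. exp (J e) * (if e \<in> contour M rep \<epsilon> \<sigma> then exp (- 2 * J e) else 1))"
    proof (rule prod.cong[OF refl])
      fix e assume e: "e \<in> edges M"
      then show "exp (edge_sign (rep \<epsilon>) e * J e * spin_product (dual M) \<sigma> e)
          = exp (J e) * (if e \<in> contour M rep \<epsilon> \<sigma> then exp (- 2 * J e) else 1)"
        using spin_product_cases[OF \<sigma> left_pair_in left_pair_in, OF e e]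
        by (auto simp: contour_def edge_sign_def exp_add[symmetric])
    qed
    also have "\<dots> = (\<Prod>e\<in>edges M. exp (J e)) *
        (\<Prod>e\<in>edges M \<inter> contour M rep \<epsilon> \<sigma>. exp (- 2 * J e))"
      by (simp only: prod.distrib prod.inter_restrict[OF finite_edges, symmetric])
    also have "edges M \<inter> contour M rep \<epsilon> \<sigma> = contour M rep \<epsilon> \<sigma>" by (auto simp: contour_def)
    finally show ?thesis .
  qed
  then have "Z_Ising M rep J \<epsilon> = (\<Sum>\<sigma>\<in>spins (dual M).
      (\<Prod>e\<in>edges M. exp (J e)) * (\<Prod>e\<in>contour M rep \<epsilon> \<sigma>. exp (- 2 * J e)))"
    unfolding Z_Ising_def by (rule sum.cong[OF refl])
  also have "\<dots> = 2 * (\<Sum>P\<in>polygons M \<epsilon>. (\<Prod>e\<in>edges M. exp (J e)) * (\<Prod>e\<in>P. exp (- 2 * J e)))"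
    using rep by (rule sum_contour)
  finally show ?thesis by (simp add: sum_distrib_left[symmetric])
qed

lemma spin_of:
  assumes "P \<in> polygon_configs M" and "rep (hclass M P) \<in> polygons M (hclass M P)"
  shows "spin_of M rep P \<in> spins (dual M)" "contour M rep (hclass M P) (spin_of M rep P) = P"
  using someI_ex[OF contour_surj[of P rep, OF assms, unfolded Bex_def]] by (simp_all add: spin_of_def)

text \<open>
  The two contours are taken with the same representative, so its signs cancel in the product of
  the two spin configurations.
\<close>

lemma XOR_eq_sym_diff:
  assumes P: "P \<in> polygon_configs M" and Q: "Q \<in> polygon_configs M"
    and "hclass M P = hclass M Q" and rep: "rep (hclass M P) \<in> polygons M (hclass M P)"
  shows "XOR M rep (P, Q) = sym_diff P Q"
proof -
  let ?\<sigma> = "spin_of M rep P" and ?\<sigma>' = "spin_of M rep Q" and ?s = "edge_sign (rep (hclass M P))"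
  have \<sigma>: "?\<sigma> \<in> spins (dual M)" "contour M rep (hclass M P) ?\<sigma> = P"
    using spin_of[of P rep, OF P rep] .
  have \<sigma>': "?\<sigma>' \<in> spins (dual M)" "contour M rep (hclass M P) ?\<sigma>' = Q"
    using spin_of[of Q rep, OF Q] rep assms(3) by simp_all
  have "e \<in> XOR M rep (P, Q) \<longleftrightarrow> e \<in> sym_diff P Q" for e
  proof (cases "e \<in> edges M")
    case True
    have pm: "\<sigma> (left M (e, b)) \<in> {- 1, 1}" if "\<sigma> \<in> spins (dual M)" for \<sigma> b
      using PiE_mem[OF that[unfolded spins_def], of "left M (e, b)"] left_pair_in[OF True] by simp
    have "e \<in> P \<longleftrightarrow> ?s e * spin_product (dual M) ?\<sigma> e = - 1"
      by (subst \<sigma>(2)[symmetric]) (simp add: contour_def True)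
    moreover have "e \<in> Q \<longleftrightarrow> ?s e * spin_product (dual M) ?\<sigma>' e = - 1"
      by (subst \<sigma>'(2)[symmetric]) (simp add: contour_def True)
    ultimately show ?thesis
      using pm[OF \<sigma>(1), of True] pm[OF \<sigma>(1), of False] pm[OF \<sigma>'(1), of True] pm[OF \<sigma>'(1), of False]
        True
      by (auto simp: XOR_def spin_product_def edge_sign_def)
  next
    case False
    then show ?thesis using P Q by (auto simp: XOR_def polygon_configs_def)
  qed
  then show ?thesis by blast
qed

section \<open>Pairs of polygon configurations with a given symmetric difference\<close>

lemma homologous_pairs:
  "(\<Union>\<epsilon>\<in>carrier (H1 M). polygons M \<epsilon> \<times> polygons M \<epsilon>)
    = {(P, Q). P \<in> polygon_configs M \<and> Q \<in> polygon_configs M \<and> hclass M P = hclass M Q}"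
  by (auto simp: carrier_H1 polygons_def)

text \<open>
  Once the symmetric difference \<open>S\<close> is a boundary, the two members of a pair are automatically
  homologous, and the first one is an arbitrary polygon configuration of any class.
\<close>

lemma sum_homologous_pairs:
  fixes w :: "'e set \<Rightarrow> real"
  assumes S: "S \<in> boundaries M"
    and rep: "\<And>\<epsilon>. \<epsilon> \<in> carrier (H1 M) \<Longrightarrow> rep \<epsilon> \<in> polygons M \<epsilon>"
  shows "(\<Sum>(P, Q) | (P, Q) \<in> (\<Union>\<epsilon>\<in>carrier (H1 M). polygons M \<epsilon> \<times> polygons M \<epsilon>) \<and>
      XOR M rep (P, Q) = S. w P * w Q) = (\<Sum>P\<in>polygon_configs M. w P * w (sym_diff P S))"
proof (rule sum.reindex_bij_witness[of _ "\<lambda>P. (P, sym_diff P S)" fst])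
  have XOR: "XOR M rep (P, Q) = sym_diff P Q"
    if "P \<in> polygon_configs M" "Q \<in> polygon_configs M" "hclass M P = hclass M Q" for P Q
    using that by (intro XOR_eq_sym_diff rep) (auto simp: carrier_H1)
  have cancel: "sym_diff P (sym_diff P S) = S" for P by blast
  fix P assume P: "P \<in> polygon_configs M"
  have "sym_diff P S \<in> polygon_configs M"
    using polygon_configs_sym_diff[OF P] S boundaries_subset by blast
  moreover have "hclass M P = hclass M (sym_diff P S)"
    unfolding hclass_eq_iff cancel by (rule S)
  ultimately show "(P, sym_diff P S) \<in> {(P, Q). (P, Q) \<in>
      (\<Union>\<epsilon>\<in>carrier (H1 M). polygons M \<epsilon> \<times> polygons M \<epsilon>) \<and> XOR M rep (P, Q) = S}"
    using P XOR by (simp add: homologous_pairs cancel)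
next
  fix X assume "X \<in> {(P, Q). (P, Q) \<in>
      (\<Union>\<epsilon>\<in>carrier (H1 M). polygons M \<epsilon> \<times> polygons M \<epsilon>) \<and> XOR M rep (P, Q) = S}"
  then obtain P Q where X: "X = (P, Q)" "P \<in> polygon_configs M" "Q \<in> polygon_configs M"
    "hclass M P = hclass M Q" "XOR M rep (P, Q) = S" by (auto simp: homologous_pairs)
  then have "S = sym_diff P Q"
    using XOR_eq_sym_diff[of P Q rep] rep by (auto simp: carrier_H1)
  then have "sym_diff P S = Q" by blast
  then show "(fst X, sym_diff (fst X) S) = X" "fst X \<in> polygon_configs M"
    "w (fst X) * w (sym_diff (fst X) S) = (case X of (P, Q) \<Rightarrow> w P * w Q)"
    using X by simp_all
qed simp

text \<open>
  Euler's formula, in the form that determines the constant: the dual boundaries number 2 to the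
  power of the number of vertices of \<open>M\<close> minus 1.
\<close>

lemma card_dual_boundaries:
  "2 ^ (card (edges M) + 2) = 2 ^ (card (faces M) + 2 * g + 1) * card (boundaries (dual M))"
proof -
  have "card (edges M) + 3 = card (faces M) + 2 * g + 1 + card (verts M)"
    using euler by linarith
  then have "(2::nat) ^ (card (edges M) + 3) = 2 ^ (card (faces M) + 2 * g + 1 + card (verts M))"
    by (rule arg_cong)
  also have "\<dots> = 2 ^ (card (faces M) + 2 * g + 1) * (2 * card (boundaries (dual M)))"
    by (simp add: power_add cellular_embedding.card_boundaries[OF dual_cellular_embedding])
  finally show ?thesis by (simp add: power_add)
qed

text \<open>
  The unnormalised weight of the event that \<open>XOR\<close> equals \<open>S\<close>.  The constant in front is the same for
  all \<open>S\<close>: it is part of the partition function, and cancels in the probability.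
\<close>

lemma double_weight_sum:
  fixes J :: "'e \<Rightarrow> real"
  assumes S: "S \<in> boundaries M"
    and rep: "\<And>\<epsilon>. \<epsilon> \<in> carrier (H1 M) \<Longrightarrow> rep \<epsilon> \<in> polygons M \<epsilon>"
  shows "(\<Sum>(P, Q) | (P, Q) \<in> (\<Union>\<epsilon>\<in>carrier (H1 M). polygons M \<epsilon> \<times> polygons M \<epsilon>) \<and>
      XOR M rep (P, Q) = S.
      (2 * (\<Prod>e\<in>edges M. exp (J e)))\<^sup>2 * (\<Prod>e\<in>P. exp (- 2 * J e)) * (\<Prod>e\<in>Q. exp (- 2 * J e)))
    = 2 ^ (card (faces M) + 2 * g + 1) * (\<Prod>e\<in>edges M. cosh (2 * J e)) *
      ((\<Prod>e\<in>S. 2 * exp (- 2 * J e) / (1 + exp (- 4 * J e))) *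
      (\<Sum>Q | Q \<in> boundaries (dual M) \<and> S \<inter> Q = {}.
        \<Prod>e\<in>Q. (1 - exp (- 4 * J e)) / (1 + exp (- 4 * J e))))" (is "?L = ?K * ?N")
proof -
  let ?w = "\<lambda>P. \<Prod>e\<in>P. exp (- 2 * J e)" and ?b = "real (card (boundaries (dual M)))"
  let ?W = "\<Sum>P\<in>polygon_configs M. ?w P * ?w (sym_diff P S)"
  have "card (boundaries (dual M)) \<noteq> 0"
    using card_gt_0_iff empty_boundary[of "dual M"]
      cellular_embedding.finite_boundaries[OF dual_cellular_embedding] by blast
  then have b: "?b \<noteq> 0" by (simp only: of_nat_eq_0_iff not_False_eq_True)
  have sq: "(exp (- 2 * J e))\<^sup>2 = exp (- 4 * J e)" for e
    by (simp add: power2_eq_square exp_add[symmetric])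
  have "S \<subseteq> edges M" using S by (auto simp: boundaries_def face_boundary_def)
  from sum_shifted_polygon_configs[OF this, of "\<lambda>e. exp (- 2 * J e)", unfolded sq]
  have W: "?b * ?W = (\<Prod>e\<in>edges M. 1 + exp (- 4 * J e)) * ?N" .
  have cosh: "(exp (J e))\<^sup>2 * (1 + exp (- 4 * J e)) = 2 * cosh (2 * J e)" for e
    by (simp add: power2_eq_square cosh_def distrib_left exp_add[symmetric])
  have K: "(2 * (\<Prod>e\<in>edges M. exp (J e)))\<^sup>2 * (\<Prod>e\<in>edges M. 1 + exp (- 4 * J e)) = ?b * ?K"
  proof -
    have "(2 * (\<Prod>e\<in>edges M. exp (J e)))\<^sup>2 * (\<Prod>e\<in>edges M. 1 + exp (- 4 * J e))
        = 4 * (\<Prod>e\<in>edges M. 2 * cosh (2 * J e))"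
      by (simp only: cosh[symmetric]) (simp add: power_mult_distrib prod.distrib prod_power_distrib)
    also have "\<dots> = real (2 ^ (card (edges M) + 2)) * (\<Prod>e\<in>edges M. cosh (2 * J e))"
      by (simp add: prod.distrib power_add)
    finally show ?thesis unfolding card_dual_boundaries by simp
  qed
  have "?L = (\<Sum>(P, Q) | (P, Q) \<in> (\<Union>\<epsilon>\<in>carrier (H1 M). polygons M \<epsilon> \<times> polygons M \<epsilon>) \<and>
      XOR M rep (P, Q) = S. (2 * (\<Prod>e\<in>edges M. exp (J e)))\<^sup>2 * (?w P * ?w Q))"
    by (simp only: mult.assoc)
  also have "\<dots> = (2 * (\<Prod>e\<in>edges M. exp (J e)))\<^sup>2 *
      (\<Sum>(P, Q) | (P, Q) \<in> (\<Union>\<epsilon>\<in>carrier (H1 M). polygons M \<epsilon> \<times> polygons M \<epsilon>) \<and>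
      XOR M rep (P, Q) = S. ?w P * ?w Q)"
    by (simp only: sum_distrib_left case_prod_unfold)
  also have "(\<Sum>(P, Q) | (P, Q) \<in> (\<Union>\<epsilon>\<in>carrier (H1 M). polygons M \<epsilon> \<times> polygons M \<epsilon>) \<and>
      XOR M rep (P, Q) = S. ?w P * ?w Q) = ?W"
    by (rule sum_homologous_pairs[OF S]) (rule rep)
  finally have "?b * ?L = (2 * (\<Prod>e\<in>edges M. exp (J e)))\<^sup>2 * (?b * ?W)" by (simp only: mult_ac)
  also have "\<dots> = ?b * (?K * ?N)" unfolding W using K by (simp only: mult.assoc[symmetric])
  finally have "?b * ?L = ?b * (?K * ?N)" .
  then show ?thesis by (simp only: mult_left_cancel[OF b])
qed

lemma finite_homologous_pairs: "finite (\<Union>\<epsilon>\<in>carrier (H1 M). polygons M \<epsilon> \<times> polygons M \<epsilon>)"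
  unfolding homologous_pairs
  by (rule finite_subset[OF _ finite_cartesian_product[OF finite_polygon_configs finite_polygon_configs]])
    auto

lemma Z_dIsing_eq_sum_pairs:
  assumes rep: "\<And>\<epsilon>. \<epsilon> \<in> carrier (H1 M) \<Longrightarrow> rep \<epsilon> \<in> polygons M \<epsilon>"
  shows "Z_dIsing M rep J =
    (\<Sum>(P, Q) \<in> (\<Union>\<epsilon>\<in>carrier (H1 M). polygons M \<epsilon> \<times> polygons M \<epsilon>).
      (2 * (\<Prod>e\<in>edges M. exp (J e)))\<^sup>2 * (\<Prod>e\<in>P. exp (- 2 * J e)) * (\<Prod>e\<in>Q. exp (- 2 * J e)))"
proof -
  let ?w = "\<lambda>P. \<Prod>e\<in>P. exp (- 2 * J e)" and ?c = "2 * (\<Prod>e\<in>edges M. exp (J e))"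
  have fin: "finite (polygons M \<epsilon>)" for \<epsilon>
    using finite_polygon_configs by (simp add: polygons_def)
  have "Z_dIsing M rep J
      = (\<Sum>\<epsilon>\<in>carrier (H1 M). \<Sum>(P, Q) \<in> polygons M \<epsilon> \<times> polygons M \<epsilon>. ?c\<^sup>2 * ?w P * ?w Q)"
    unfolding Z_dIsing_def
  proof (rule sum.cong[OF refl])
    fix \<epsilon> assume \<epsilon>: "\<epsilon> \<in> carrier (H1 M)"
    have "(Z_Ising M rep J \<epsilon>)\<^sup>2 = ?c\<^sup>2 * ((\<Sum>P\<in>polygons M \<epsilon>. ?w P) * (\<Sum>Q\<in>polygons M \<epsilon>. ?w Q))"
      unfolding Z_Ising_low_temperature[of rep, OF rep[OF \<epsilon>]] by (simp only: power2_eq_square mult_ac)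
    also have "\<dots> = (\<Sum>(P, Q) \<in> polygons M \<epsilon> \<times> polygons M \<epsilon>. ?c\<^sup>2 * ?w P * ?w Q)"
      unfolding sum_product sum.cartesian_product
      by (simp only: sum_distrib_left case_prod_unfold mult.assoc)
    finally show "(Z_Ising M rep J \<epsilon>)\<^sup>2 = (\<Sum>(P, Q) \<in> polygons M \<epsilon> \<times> polygons M \<epsilon>. ?c\<^sup>2 * ?w P * ?w Q)" .
  qed
  also have "\<dots> = (\<Sum>(P, Q) \<in> (\<Union>\<epsilon>\<in>carrier (H1 M). polygons M \<epsilon> \<times> polygons M \<epsilon>). ?c\<^sup>2 * ?w P * ?w Q)"
    by (rule sum.UNION_disjoint[symmetric])
      (use fin finite_polygon_configs in \<open>auto simp: carrier_H1 polygons_def\<close>)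
  finally show ?thesis .
qed

lemma Z_dIsing_eq:
  assumes rep: "\<And>\<epsilon>. \<epsilon> \<in> carrier (H1 M) \<Longrightarrow> rep \<epsilon> \<in> polygons M \<epsilon>"
  shows "Z_dIsing M rep J =
    2 ^ (card (faces M) + 2 * g + 1) * (\<Prod>e\<in>edges M. cosh (2 * J e)) *
    (\<Sum>(P, P') \<in> {(P, P'). P \<in> boundaries M \<and> P' \<in> boundaries (dual M) \<and> P \<inter> P' = {}}.
      (\<Prod>e\<in>P. 2 * exp (- 2 * J e) / (1 + exp (- 4 * J e))) *
      (\<Prod>e\<in>P'. (1 - exp (- 4 * J e)) / (1 + exp (- 4 * J e))))"
proof -
  let ?X = "\<Union>\<epsilon>\<in>carrier (H1 M). polygons M \<epsilon> \<times> polygons M \<epsilon>"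
  let ?D = "\<lambda>S. {Q. Q \<in> boundaries (dual M) \<and> S \<inter> Q = {}}"
  let ?u = "\<lambda>P. \<Prod>e\<in>P. 2 * exp (- 2 * J e) / (1 + exp (- 4 * J e))"
  let ?v = "\<lambda>P. \<Prod>e\<in>P. (1 - exp (- 4 * J e)) / (1 + exp (- 4 * J e))"
  let ?h = "\<lambda>(P, Q). (2 * (\<Prod>e\<in>edges M. exp (J e)))\<^sup>2 *
    (\<Prod>e\<in>P. exp (- 2 * J e)) * (\<Prod>e\<in>Q. exp (- 2 * J e))"
  let ?K = "2 ^ (card (faces M) + 2 * g + 1) * (\<Prod>e\<in>edges M. cosh (2 * J e))"
  have XOR: "XOR M rep ` ?X \<subseteq> boundaries M"
  proof
    fix S assume "S \<in> XOR M rep ` ?X"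
    then obtain P Q where PQ: "P \<in> polygon_configs M" "Q \<in> polygon_configs M" "hclass M P = hclass M Q"
      "S = XOR M rep (P, Q)" unfolding homologous_pairs by auto
    then have "S = sym_diff P Q"
      using XOR_eq_sym_diff[of P Q rep] rep by (auto simp: carrier_H1)
    then show "S \<in> boundaries M" using PQ(3) by (simp add: hclass_eq_iff)
  qed
  have "Z_dIsing M rep J = sum ?h ?X" by (rule Z_dIsing_eq_sum_pairs) (rule rep)
  also have "\<dots> = (\<Sum>S\<in>boundaries M. sum ?h {X \<in> ?X. XOR M rep X = S})"
    by (rule sum.group[OF finite_homologous_pairs finite_boundaries XOR, symmetric])
  also have "\<dots> = (\<Sum>S\<in>boundaries M. ?K * (?u S * (\<Sum>Q\<in>?D S. ?v Q)))"
  proof (rule sum.cong[OF refl])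
    fix S assume S: "S \<in> boundaries M"
    have "{X \<in> ?X. XOR M rep X = S} = {(P, Q). (P, Q) \<in> ?X \<and> XOR M rep (P, Q) = S}" by blast
    then show "sum ?h {X \<in> ?X. XOR M rep X = S} = ?K * (?u S * (\<Sum>Q\<in>?D S. ?v Q))"
      by (simp only: double_weight_sum[OF S rep])
  qed
  also have "\<dots> = ?K * (\<Sum>S\<in>boundaries M. \<Sum>Q\<in>?D S. ?u S * ?v Q)"
    by (simp only: sum_distrib_left)
  also have "(\<Sum>S\<in>boundaries M. \<Sum>Q\<in>?D S. ?u S * ?v Q)
      = (\<Sum>(S, Q)\<in>(SIGMA S:boundaries M. ?D S). ?u S * ?v Q)"
    using finite_boundaries cellular_embedding.finite_boundaries[OF dual_cellular_embedding]
    by (intro sum.Sigma) auto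
  also have "(SIGMA S:boundaries M. ?D S)
      = {(P, P'). P \<in> boundaries M \<and> P' \<in> boundaries (dual M) \<and> P \<inter> P' = {}}" by auto
  finally show ?thesis .
qed

end

theorem corollary14:
  fixes G :: "('v, 'e, 'f) emb_graph" and g :: nat
    and rep :: "'e set set \<Rightarrow> 'e set" and J :: "'e \<Rightarrow> real"
  assumes "cellular_embedding G g"
    and "\<And>e. e \<in> edges (dual G) \<Longrightarrow> J e > 0"
    and "\<And>\<epsilon>. \<epsilon> \<in> carrier (H1 G) \<Longrightarrow> rep \<epsilon> \<in> polygons G \<epsilon>"
  shows "Z_dIsing G rep J =
      2 ^ (card (verts (dual G)) + 2 * g + 1) * (\<Prod>e\<in>edges G. cosh (2 * J e)) *
      (\<Sum>(P, P') \<in> {(P, P'). P \<in> null_polygons G \<and> P' \<in> null_polygons (dual G) \<and> P \<inter> P' = {}}.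
        (\<Prod>e\<in>P. 2 * exp (- 2 * J e) / (1 + exp (- 4 * J e))) *
        (\<Prod>e\<in>P'. (1 - exp (- 4 * J e)) / (1 + exp (- 4 * J e)))) \<and>
    (\<forall>P \<in> null_polygons G.
      measure (P_dIsing G rep J) {X \<in> space (P_dIsing G rep J). XOR G rep X = P} =
      (\<Prod>e\<in>P. 2 * exp (- 2 * J e) / (1 + exp (- 4 * J e))) *
      (\<Sum>P' \<in> {P' \<in> null_polygons (dual G). P \<inter> P' = {}}.
        \<Prod>e\<in>P'. (1 - exp (- 4 * J e)) / (1 + exp (- 4 * J e))) /
      (\<Sum>(Q, Q') \<in> {(Q, Q'). Q \<in> null_polygons G \<and> Q' \<in> null_polygons (dual G) \<and> Q \<inter> Q' = {}}.
        (\<Prod>e\<in>Q. 2 * exp (- 2 * J e) / (1 + exp (- 4 * J e))) *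
        (\<Prod>e\<in>Q'. (1 - exp (- 4 * J e)) / (1 + exp (- 4 * J e)))))"
proof -
  interpret cellular_embedding G g by fact
  have rep: "rep \<epsilon> \<in> polygons G \<epsilon>" if "\<epsilon> \<in> carrier (H1 G)" for \<epsilon>
    using assms(3) that .
  have null: "null_polygons G = boundaries G" "null_polygons (dual G) = boundaries (dual G)"
    using null_polygons_eq_boundaries
      cellular_embedding.null_polygons_eq_boundaries[OF dual_cellular_embedding] .
  let ?X = "\<Union>\<epsilon>\<in>carrier (H1 G). polygons G \<epsilon> \<times> polygons G \<epsilon>"
  let ?K = "2 ^ (card (faces G) + 2 * g + 1) * (\<Prod>e\<in>edges G. cosh (2 * J e))"
  let ?h = "\<lambda>(P, Q). (2 * (\<Prod>e\<in>edges G. exp (J e)))\<^sup>2 *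
    (\<Prod>e\<in>P. exp (- 2 * J e)) * (\<Prod>e\<in>Q. exp (- 2 * J e))"
  let ?u = "\<lambda>P. \<Prod>e\<in>P. 2 * exp (- 2 * J e) / (1 + exp (- 4 * J e))"
  let ?v = "\<lambda>P. \<Prod>e\<in>P. (1 - exp (- 4 * J e)) / (1 + exp (- 4 * J e))"
  define N where "N = (\<Sum>(P, P') \<in>
    {(P, P'). P \<in> boundaries G \<and> P' \<in> boundaries (dual G) \<and> P \<inter> P' = {}}. ?u P * ?v P')"
  have Z: "Z_dIsing G rep J = ?K * N"
    unfolding N_def by (rule Z_dIsing_eq) (rule rep)
  have K: "?K \<noteq> 0" using finite_edges by simp
  have "measure (P_dIsing G rep J) {X \<in> space (P_dIsing G rep J). XOR G rep X = S}
      = ?u S * (\<Sum>P' \<in> {P' \<in> boundaries (dual G). S \<inter> P' = {}}. ?v P') / N"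
    if S: "S \<in> boundaries G" for S
  proof -
    define p where "p X = ?h X / Z_dIsing G rep J" for X
    define A where "A = {(P, Q). (P, Q) \<in> ?X \<and> XOR G rep (P, Q) = S}"
    have law: "P_dIsing G rep J = point_measure ?X (\<lambda>X. ennreal (p X))"
      by (simp add: P_dIsing_def p_def case_prod_unfold)
    have event: "{X \<in> space (P_dIsing G rep J). XOR G rep X = S} = A"
      unfolding law A_def space_point_measure by blast
    have nonneg: "p X \<ge> 0" for X
    proof -
      have "Z_dIsing G rep J \<ge> 0" unfolding Z_dIsing_def by (simp add: sum_nonneg)
      moreover have "?h X \<ge> 0" by (simp add: case_prod_unfold prod_nonneg)
      ultimately show ?thesis unfolding p_def by (rule divide_nonneg_nonneg[rotated])
    qed
    have "A \<subseteq> ?X" unfolding A_def by blast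
    then have "measure (P_dIsing G rep J) A = sum p A"
      unfolding law using measure_point_measure_finite_if[OF finite_homologous_pairs nonneg, where X = A]
      by (simp only: if_True)
    also have "\<dots> = sum ?h A / Z_dIsing G rep J"
      unfolding sum_divide_distrib by (rule sum.cong[OF refl p_def])
    also have "sum ?h A = ?K * (?u S * (\<Sum>P' \<in> {P' \<in> boundaries (dual G). S \<inter> P' = {}}. ?v P'))"
      unfolding A_def by (rule double_weight_sum[OF S]) (rule rep)
    finally show ?thesis unfolding event Z using K by simp
  qed
  then show ?thesis
    unfolding null dual_simps(1) Z N_def[symmetric] by blast
qed

end
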